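(* Let $D_0>0$ and $R>0$, and let $\mathbf g:\mathbb R\times\mathbb C^d\to\mathbb C^d$ be a periodic vector field with Fourier coefficients $\mathbf g_{\boldsymbol\alpha}(t)=[g_{1,\boldsymbol\alpha}(t),\ldots,g_{d,\boldsymbol\alpha}(t)]^T$, $\boldsymbol\alpha\in\mathbb Z^d$, such that (1) $\mathbf g_{\boldsymbol\alpha}(t)=\mathbf 0$ for all $\boldsymbol\alpha\in\mathbb Z^d\setminus\mathbb Z_+^d$ and $t\ge 0$; and (2) $\sup_{t\ge 0}\sum_{|\boldsymbol\alpha|=k}\sum_{j=1}^d |g_{j,\boldsymbol\alpha}(t)|\le D_0R^{-k}$ for all integers $k\ge 0$. Let $\mathbf x(t)=[x_1(t),\ldots,x_d(t)]^T$ be the solution of $\dot{\mathbf x}=\mathbf g(t,\mathbf x)$, $t\ge0$, with initial state $\mathbf x(0)=\mathbf x_0=[x_{0,1},\ldots,x_{0,d}]^T\in\mathbb C^d$ satisfying $$\|\exp(i\mathbf x_0)\|_\infty=\exp\big(-\min_{1\le j\le d}\Im x_{0,j}\big)<e^{-1}R .$$ For $N\ge1$ let $\mathbf v_{1,N}(t)=[v_{1,N}(t),\ldots,v_{d,N}(t)]^T$ be the first block of the solution of the finite-section approximation of order $N$ of the Carleman-Fourier linearization (defined in the context). Set $$T_{CF}^*=\frac{e-1}{D_0(2e-1)}\big(\ln R-\ln\|\exp(i\mathbf x_0)\|_\infty-1\big)>0$$ and $$C_0=\frac{1}{\sqrt{2\pi}(e-1)}\exp\Big(\frac{3e-1}{2e-1}\max_{1\le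 j\le d}\Im x_{0,j}+\frac{3e-1}{2e-1}\ln R-\frac{e}{2e-1}\Big).$$ Then for every $N\ge1$ and all $0\le t\le T_{CF}^*$, $$\max_{1\le j\le d}\big|v_{j,N}(t)e^{-ix_j(t)}-1\big|\le C_0N^{-3/2}e^{D_0tN}\Big(\frac{e\,\|\exp(i\mathbf x_0)\|_\infty}{R}\Big)^{(e-1)N/(2e-1)} .$$
   Context: Notation: $\mathbb Z_+^d$ is the set of $d$-tuples of nonnegative integers; for $\boldsymbol\alpha\in\mathbb Z^d$, $|\boldsymbol\alpha|=|\alpha_1|+\cdots+|\alpha_d|$ and $\boldsymbol\alpha\mathbf x=\alpha_1x_1+\cdots+\alpha_dx_d$; $\mathbb Z_{+,k}^d=\{\boldsymbol\alpha\in\mathbb Z_+^d:|\boldsymbol\alpha|=k\}$. $\Im$ denotes imaginary part; $\exp(i\mathbf x)$ is taken componentwise; $\|\cdot\|_p$ is the standard $p$-norm on $\mathbb C^d$. The periodic vector field $\mathbf g$ is given by its Fourier expansion $\mathbf g(t,\mathbf x)=\sum_{\boldsymbol\alpha\in\mathbb Z^d}\mathbf g_{\boldsymbol\alpha}(t)e^{i\boldsymbol\alpha\mathbf x}$ (which, under (1) and (2), converges when $\min_j\Im x_j>-\ln R$). Carleman-Fourier linearization and finite sections: put $\mathbf w_k=[e^{i\boldsymbol\alpha\mathbf x}]_{\boldsymbol\alpha\in\mathbb Z_{+,k}^d}$, $k\ge1$, and $$\mathbf B_{k,l}(t)=\big[\,i\,\boldsymbol\alpha^T\mathbf g_{\boldsymbol\beta-\boldsymbol\alpha}(t)\,\big]_{\boldsymbol\alpha\in\mathbb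 Z_{+,k}^d,\ \boldsymbol\beta\in\mathbb Z_{+,l}^d},\qquad k,l\ge1 .$$ Then $\dot{\mathbf w}_k=\sum_{l\ge k}\mathbf B_{k,l}(t)\mathbf w_l$. The finite-section approximation of order $N\ge1$ is the finite linear ODE system $$\dot{\mathbf v}_{k,N}(t)=\sum_{l=k}^N\mathbf B_{k,l}(t)\mathbf v_{l,N}(t),\qquad \mathbf v_{k,N}(0)=\mathbf w_k(0)=[e^{i\boldsymbol\alpha\mathbf x_0}]_{\boldsymbol\alpha\in\mathbb Z_{+,k}^d},\qquad 1\le k\le N .$$ Its first block $\mathbf v_{1,N}$ is indexed by the unit vectors $\mathbf e_1,\ldots,\mathbf e_d$; its entry with index $\mathbf e_j$ is the scalar denoted $v_{j,N}(t)$. *)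

theory Defs
  imports "HOL-Analysis.Analysis"
begin

definition mabs :: "int ^ 'd::finite \<Rightarrow> nat" where
  "mabs \<alpha> = nat (\<Sum>j\<in>UNIV. \<bar>\<alpha> $ j\<bar>)"

definition nonneg_idx :: "(int ^ 'd::finite) set" where
  "nonneg_idx = {\<alpha>. \<forall>j. 0 \<le> \<alpha> $ j}"

definition nonneg_idx_deg :: "nat \<Rightarrow> (int ^ 'd::finite) set" where
  "nonneg_idx_deg k = {\<alpha> \<in> nonneg_idx. mabs \<alpha> = k}"

definition idx_dot :: "int ^ 'd::finite \<Rightarrow> complex ^ 'd \<Rightarrow> complex" where
  "idx_dot \<alpha> z = (\<Sum>j\<in>UNIV. of_int (\<alpha> $ j) * z $ j)"

definition exp_i :: "complex ^ 'd::finite \<Rightarrow> complex ^ 'd" where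
  "exp_i z = (\<chi> j. exp (\<i> * z $ j))"

text \<open>The library's \<open>infnorm\<close> on \<open>complex ^ 'd\<close> treats real and imaginary
  parts as separate coordinates, so it is not the maximum norm over the complex components.\<close>

definition max_norm :: "complex ^ 'd::finite \<Rightarrow> real" where
  "max_norm z = Max (range (\<lambda>j. norm (z $ j)))"

definition max_Im :: "complex ^ 'd::finite \<Rightarrow> real" where
  "max_Im z = Max (range (\<lambda>j. Im (z $ j)))"

definition periodic_field :: "(real \<Rightarrow> complex ^ 'd::finite \<Rightarrow> complex ^ 'd) \<Rightarrow> bool" where
  "periodic_field g \<longleftrightarrow> (\<forall>t z j. g t (z + axis j (of_real (2 * pi))) = g t z)"

text \<open>\<open>G t \<alpha>\<close> is the Fourier coefficient of \<open>g t\<close> with index \<open>\<alpha>\<close>. The expansion is required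
  for nonnegative times and on the region \<open>min_j Im z_j > - ln R\<close>, where the coefficient bounds
  of the theorem make the series converge absolutely; \<open>g\<close> is unconstrained elsewhere.\<close>

definition has_Fourier_expansion ::
  "(real \<Rightarrow> complex ^ 'd::finite \<Rightarrow> complex ^ 'd) \<Rightarrow> (real \<Rightarrow> int ^ 'd \<Rightarrow> complex ^ 'd) \<Rightarrow> real \<Rightarrow> bool"
  where
  "has_Fourier_expansion g G R \<longleftrightarrow>
     (\<forall>t\<ge>0. \<forall>z. (\<forall>j. - ln R < Im (z $ j)) \<longrightarrow>
        ((\<lambda>\<alpha>. exp (\<i> * idx_dot \<alpha> z) *s G t \<alpha>) has_sum g t z) UNIV)"

definition solves_ivp ::
  "(real \<Rightarrow> 'a \<Rightarrow> 'a) \<Rightarrow> 'a \<Rightarrow> real set \<Rightarrow> (real \<Rightarrow> 'a::real_normed_vector) \<Rightarrow> bool" where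
  "solves_ivp f y0 S y \<longleftrightarrow>
     y 0 = y0 \<and> (\<forall>t\<in>S. (y has_vector_derivative f t (y t)) (at t within S))"

text \<open>The entry of the block \<open>B_{k,l}(t)\<close> in row \<open>\<alpha>\<close> and column \<open>\<beta>\<close>; the block is recovered
  from \<open>k = mabs \<alpha>\<close>, \<open>l = mabs \<beta>\<close>.\<close>

definition carleman_entry ::
  "(real \<Rightarrow> int ^ 'd::finite \<Rightarrow> complex ^ 'd) \<Rightarrow> real \<Rightarrow> int ^ 'd \<Rightarrow> int ^ 'd \<Rightarrow> complex" where
  "carleman_entry G t \<alpha> \<beta> = \<i> * idx_dot \<alpha> (G t (\<beta> - \<alpha>))"

text \<open>\<open>v t \<alpha>\<close> is the entry with index \<open>\<alpha>\<close> of the block \<open>v_{k,N}(t)\<close>, \<open>k = mabs \<alpha>\<close>; values of \<open>v\<close>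
  at other indices are irrelevant.\<close>

definition finite_section_solution ::
  "(real \<Rightarrow> int ^ 'd::finite \<Rightarrow> complex ^ 'd) \<Rightarrow> complex ^ 'd \<Rightarrow> nat \<Rightarrow> real set \<Rightarrow>
    (real \<Rightarrow> int ^ 'd \<Rightarrow> complex) \<Rightarrow> bool" where
  "finite_section_solution G x0 N S v \<longleftrightarrow>
     (\<forall>k\<in>{1..N}. \<forall>\<alpha>\<in>nonneg_idx_deg k.
        v 0 \<alpha> = exp (\<i> * idx_dot \<alpha> x0) \<and>
        (\<forall>t\<in>S. ((\<lambda>s. v s \<alpha>) has_vector_derivative
           (\<Sum>l=k..N. \<Sum>\<beta>\<in>nonneg_idx_deg l. carleman_entry G t \<alpha> \<beta> * v t \<beta>)) (at t within S)))"

definition T_CF :: "real \<Rightarrow> real \<Rightarrow> complex ^ 'd::finite \<Rightarrow> real" where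
  "T_CF D0 R x0 =
     (exp 1 - 1) / (D0 * (2 * exp 1 - 1)) * (ln R - ln (max_norm (exp_i x0)) - 1)"

definition C_0 :: "real \<Rightarrow> complex ^ 'd::finite \<Rightarrow> real" where
  "C_0 R x0 = 1 / (sqrt (2 * pi) * (exp 1 - 1)) *
     exp ((3 * exp 1 - 1) / (2 * exp 1 - 1) * max_Im x0
        + (3 * exp 1 - 1) / (2 * exp 1 - 1) * ln R - exp 1 / (2 * exp 1 - 1))"

text \<open>The index sets summed over are finite, so the sums are not the default value 0.\<close>

lemma finite_mabs: "finite {\<alpha> :: int ^ 'd::finite. mabs \<alpha> = k}"
proof -
  have "{\<alpha> :: int ^ 'd. mabs \<alpha> = k} \<subseteq> (\<lambda>f. \<chi> j. f j) ` (UNIV \<rightarrow>\<^sub>E {- int k..int k})"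
  proof
    fix \<alpha> :: "int ^ 'd" assume "\<alpha> \<in> {\<alpha>. mabs \<alpha> = k}"
    then have k: "(\<Sum>j\<in>UNIV. \<bar>\<alpha> $ j\<bar>) = int k"
      by (auto simp: mabs_def sum_nonneg)
    have "\<bar>\<alpha> $ j\<bar> \<le> int k" for j
      unfolding k[symmetric] by (rule member_le_sum) auto
    then have "(\<lambda>j. \<alpha> $ j) \<in> UNIV \<rightarrow>\<^sub>E {- int k..int k}"
      by (auto simp: abs_le_iff minus_le_iff)
    moreover have "\<alpha> = (\<chi> j. \<alpha> $ j)"
      by simp
    ultimately show "\<alpha> \<in> (\<lambda>f. \<chi> j. f j) ` (UNIV \<rightarrow>\<^sub>E {- int k..int k})"
      by blast
  qed
  then show ?thesis
    by (rule finite_subset) (intro finite_imageI finite_PiE; simp)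
qed

lemma finite_nonneg_idx_deg: "finite (nonneg_idx_deg k :: (int ^ 'd::finite) set)"
  by (rule finite_subset[OF _ finite_mabs[of k]]) (auto simp: nonneg_idx_deg_def)

lemma max_norm_exp_i:
  "max_norm (exp_i (z :: complex ^ 'd::finite)) = exp (- Min (range (\<lambda>j. Im (z $ j))))"
proof -
  let ?m = "Min (range (\<lambda>j. Im (z $ j)))"
  have "?m \<in> range (\<lambda>j. Im (z $ j))"
    by (rule Min_in) auto
  then obtain i where i: "?m = Im (z $ i)"
    by blast
  show ?thesis
    unfolding max_norm_def
  proof (rule Max_eqI)
    show "y \<le> exp (- ?m)" if "y \<in> range (\<lambda>j. norm (exp_i z $ j))" for y
      using that by (auto simp: exp_i_def)
    show "exp (- ?m) \<in> range (\<lambda>j. norm (exp_i z $ j))"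
      unfolding i by (rule image_eqI[of _ _ i]) (auto simp: exp_i_def)
  qed simp
qed

end

theory Submission
  imports Defs
begin

text \<open>
  Write \<open>w\<^sub>\<alpha> = exp (\<i> \<alpha> x)\<close>, \<open>m = \<parallel>exp (\<i> x\<^sub>0)\<parallel>\<^sub>\<infinity>\<close> and \<open>\<Lambda> = ln R - ln m - 1 > 0\<close>. The proof compares
  the truncated linear system with the exact one satisfied by the \<open>w\<^sub>\<alpha>\<close> and finds a majorant of
  the error in closed form.

  Control of the solution. Where all \<open>\<bar>exp (\<i> x\<^sub>j)\<bar>\<close> are at most \<open>R q\<close> with \<open>q < 1\<close>, the decay of the
  coefficients gives \<open>\<parallel>g\<parallel> \<le> D\<^sub>0 / (1 - q)\<close>. For \<open>q \<le> 1/e\<close> the speed is therefore at most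
  \<open>K = D\<^sub>0 e / (e - 1)\<close>. Initially the solution is at distance \<open>\<Lambda>\<close> from the region where \<open>q > 1/e\<close>,
  and \<open>K T = e / (2 e - 1) \<Lambda> < \<Lambda>\<close> for the final time \<open>T\<close>, so this region is never reached:
  \<open>\<parallel>x(s) - x\<^sub>0\<parallel> \<le> K s\<close> (\<open>norm_le_barrier\<close>), and up to time \<open>t\<close> one may take \<open>q = (m / R) exp (K t)\<close>.

  Error of the finite section. Inserting \<open>w\<close> into the section of order \<open>N\<close> leaves only the columns of
  degree greater than \<open>N\<close>, a geometric tail (\<open>carleman_truncation_defect\<close>). If \<open>F\<^sub>k\<close> denotes the
  maximum of \<open>R\<^sup>-\<^sup>k \<bar>v\<^sub>\<alpha> - w\<^sub>\<alpha>\<bar>\<close> over the indices of degree \<open>k\<close>, then, in the sense of majorants,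
  \<open>F\<^sub>k' \<le> k D\<^sub>0 (F\<^sub>k + \<dots> + F\<^sub>N + C)\<close> with \<open>F\<^sub>k(0) = 0\<close> and \<open>C = q\<^sup>N\<^sup>+\<^sup>1 / (1 - q)\<close>.
  The upper triangular matrix of this system, with entry \<open>k\<close> at every place \<open>(k, l)\<close> with
  \<open>k \<le> l \<le> N\<close>, has the top eigenvalue \<open>N\<close> with the nonnegative eigenvector
  \<open>c\<^sub>k = (k / N) N\<^sup>N\<^sup>-\<^sup>k / (N - k)!\<close>, normalised by \<open>c\<^sub>N = 1\<close>. As the constant forcing is what
  shifting \<open>F\<^sub>N\<close> by \<open>C\<close> produces, \<open>C (c\<^sub>k exp (N D\<^sub>0 t) - [k = N])\<close> solves the majorant system
  exactly and has nonnegative initial values, so it dominates the error (\<open>triangular_system_bound\<close>).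

  The constants. In degree one \<open>c\<^sub>1 = N\<^sup>N\<^sup>-\<^sup>1 / N!\<close>, and Stirling's lower bound for \<open>N!\<close> turns this into
  \<open>e\<^sup>N N\<^sup>-\<^sup>3\<^sup>/\<^sup>2 / sqrt (2 \<pi>)\<close>. Since \<open>q \<le> 1/e\<close>, \<open>C \<le> q\<^sup>N / (e - 1)\<close>; and
  \<open>(e q)\<^sup>N \<le> exp (- N \<Lambda> (1 - e / (2 e - 1)))\<close>, which is the power in the assertion. Dividing by \<open>w\<close> costs
  the factor \<open>exp (Im x\<^sub>j(t))\<close>, which the control of the solution bounds; together with the factor \<open>R\<close>
  from undoing the scaling of \<open>F\<^sub>1\<close> it accounts for the exponential in \<open>C\<^sub>0\<close>.
\<close>

section \<open>Comparison principles for differential inequalities\<close>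

text \<open>
  First exit argument: the derivative bound is only assumed while \<open>\<phi>\<close> is below the barrier, but up to
  the first time of contact this suffices for the mean value inequality, which then forbids contact.
  The mean value inequality stands in for integration, as \<open>\<phi>'\<close> may fail to be integrable.
\<close>

lemma norm_less_barrier:
  fixes \<phi> :: "real \<Rightarrow> 'a::real_normed_vector"
  assumes \<phi>: "\<And>s. s \<in> {0..T} \<Longrightarrow> (\<phi> has_vector_derivative \<phi>' s) (at s within {0..T})"
    and Y: "\<And>s. s \<in> {0..T} \<Longrightarrow> (Y has_vector_derivative Y' s) (at s within {0..T})"
    and init: "norm (\<phi> 0) < Y 0"
    and bound: "\<And>s. s \<in> {0..T} \<Longrightarrow> norm (\<phi> s) \<le> Y s \<Longrightarrow> norm (\<phi>' s) \<le> Y' s"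
    and s: "s \<in> {0..T}"
  shows "norm (\<phi> s) < Y s"
proof (rule ccontr)
  assume "\<not> norm (\<phi> s) < Y s"
  have cont: "continuous_on {0..T} \<phi>" "continuous_on {0..T} Y"
    unfolding continuous_on_eq_continuous_within
    using has_vector_derivative_continuous[OF \<phi>] has_vector_derivative_continuous[OF Y] by blast+
  let ?E = "{r \<in> {0..T}. Y r \<le> norm (\<phi> r)}"
  have "closed ?E"
    using cont by (intro continuous_on_closed_Collect_le continuous_intros) auto
  then have "compact ?E"
    by (auto simp: compact_eq_bounded_closed intro: bounded_subset[OF bounded_closed_interval[of 0 T]])
  moreover have "s \<in> ?E"
    using s \<open>\<not> norm (\<phi> s) < Y s\<close> by auto
  ultimately obtain b where b: "b \<in> ?E" and least: "\<And>r. r \<in> ?E \<Longrightarrow> b \<le> r"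
    using compact_attains_inf[of ?E] by blast
  have "b \<noteq> 0"
    using b init by auto
  then have "0 < b" "b \<le> T"
    using b by auto
  have below: "norm (\<phi> r) \<le> Y r" if "0 < r" "r < b" for r
    using least[of r] that \<open>b \<le> T\<close> by force
  have "norm (\<phi> b - \<phi> 0) \<le> Y b - Y 0"
  proof (rule differentiable_bound_general[OF \<open>0 < b\<close>])
    show "continuous_on {0..b} \<phi>" "continuous_on {0..b} Y"
      using cont \<open>b \<le> T\<close> by (auto elim: continuous_on_subset)
    fix r assume r: "0 < r" "r < b"
    then have at: "at r within {0..T} = at r"
      using \<open>b \<le> T\<close> by (intro at_within_Icc_at) auto
    show "(\<phi> has_vector_derivative \<phi>' r) (at r)" "(Y has_vector_derivative Y' r) (at r)"
      using \<phi>[of r] Y[of r] r \<open>b \<le> T\<close> by (auto simp: at)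
    show "norm (\<phi>' r) \<le> Y' r"
      using bound[OF _ below] r \<open>b \<le> T\<close> by auto
  qed
  moreover have "norm (\<phi> b) \<le> norm (\<phi> b - \<phi> 0) + norm (\<phi> 0)"
    by (metis diff_add_cancel norm_triangle_ineq)
  ultimately show False
    using b init by auto
qed

text \<open>
  Continuation of an a priori estimate: a speed bound valid inside the ball of radius \<open>\<Lambda>\<close> holds for
  as long as it does not allow the trajectory to leave that ball. The barriers are \<open>K s + \<epsilon>\<close>.
\<close>

lemma norm_le_barrier:
  fixes x :: "real \<Rightarrow> 'a::real_normed_vector"
  assumes x: "\<And>s. s \<in> {0..T} \<Longrightarrow> (x has_vector_derivative x' s) (at s within {0..T})"
    and room: "K * T < \<Lambda>" and "0 \<le> K"
    and bound: "\<And>s. s \<in> {0..T} \<Longrightarrow> norm (x s - x 0) \<le> \<Lambda> \<Longrightarrow> norm (x' s) \<le> K"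
    and s: "s \<in> {0..T}"
  shows "norm (x s - x 0) \<le> K * s"
proof -
  have "norm (x s - x 0) < K * s + \<epsilon>" if \<epsilon>: "0 < \<epsilon>" "\<epsilon> \<le> \<Lambda> - K * T" for \<epsilon>
  proof (rule norm_less_barrier[OF _ _ _ _ s, where \<phi> = "\<lambda>s. x s - x 0" and \<phi>' = x' and Y' = "\<lambda>_. K"])
    fix r assume r: "r \<in> {0..T}"
    show "((\<lambda>s. x s - x 0) has_vector_derivative x' r) (at r within {0..T})"
      using has_vector_derivative_diff[OF x[OF r] has_vector_derivative_const] by simp
    show "((\<lambda>s. K * s + \<epsilon>) has_vector_derivative K) (at r within {0..T})"
      unfolding has_real_derivative_iff_has_vector_derivative[symmetric]
      by (auto intro!: derivative_eq_intros)
    have "K * r \<le> K * T"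
      using r \<open>0 \<le> K\<close> by (intro mult_left_mono) auto
    then show "norm (x' r) \<le> K" if "norm (x r - x 0) \<le> K * r + \<epsilon>"
      using bound[OF r] that \<epsilon> by linarith
  qed (use \<epsilon> in auto)
  note small = this
  show ?thesis
  proof (rule field_le_epsilon)
    fix \<epsilon> :: real assume "0 < \<epsilon>"
    then have "norm (x s - x 0) < K * s + min \<epsilon> (\<Lambda> - K * T)"
      using room by (intro small) auto
    then show "norm (x s - x 0) \<le> K * s + \<epsilon>"
      by linarith
  qed
qed

text \<open>
  Gronwall's inequality in differential form. The perturbation \<open>\<epsilon> exp (a s)\<close> of the supersolution \<open>Y\<close>
  solves the homogeneous equation, so it makes the initial inequality strict without disturbing the
  differential one.
\<close>

lemma linear_differential_inequality:
  fixes \<phi> :: "real \<Rightarrow> 'a::real_normed_vector"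
  assumes \<phi>: "\<And>s. s \<in> {0..T} \<Longrightarrow> (\<phi> has_vector_derivative \<phi>' s) (at s within {0..T})"
    and Y: "\<And>s. s \<in> {0..T} \<Longrightarrow> (Y has_vector_derivative a * Y s + f s) (at s within {0..T})"
    and a: "0 \<le> a"
    and init: "norm (\<phi> 0) \<le> Y 0"
    and bound: "\<And>s. s \<in> {0..T} \<Longrightarrow> norm (\<phi>' s) \<le> a * norm (\<phi> s) + f s"
    and s: "s \<in> {0..T}"
  shows "norm (\<phi> s) \<le> Y s"
proof -
  have strict: "norm (\<phi> s) < Y s + \<epsilon> * exp (a * s)" if "0 < \<epsilon>" for \<epsilon>
  proof (rule norm_less_barrier[OF \<phi> _ _ _ s])
    fix r assume r: "r \<in> {0..T}"
    have "((\<lambda>r. \<epsilon> * exp (a * r)) has_vector_derivative a * (\<epsilon> * exp (a * r))) (at r within {0..T})"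
      unfolding has_real_derivative_iff_has_vector_derivative[symmetric]
      by (auto intro!: derivative_eq_intros)
    from has_vector_derivative_add[OF Y[OF r] this]
    show "((\<lambda>r. Y r + \<epsilon> * exp (a * r)) has_vector_derivative
        a * (Y r + \<epsilon> * exp (a * r)) + f r) (at r within {0..T})"
      by (simp add: algebra_simps)
    show "norm (\<phi>' r) \<le> a * (Y r + \<epsilon> * exp (a * r)) + f r"
      if "norm (\<phi> r) \<le> Y r + \<epsilon> * exp (a * r)"
      using bound[OF r] mult_left_mono[OF that a] by linarith
  qed (use init that in auto)
  show ?thesis
  proof (rule field_le_epsilon)
    fix e :: real assume "0 < e"
    then show "norm (\<phi> s) \<le> Y s + e"
      using strict[of "e * exp (- (a * s))"] by (simp add: exp_minus field_simps)
  qed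
qed

section \<open>A lower Stirling bound\<close>

text \<open>
  Expresses Wallis' product by factorials, so that its limit fixes the constant in Stirling's formula.
\<close>

lemma wallis_product_closed_form:
  "(\<Prod>k=1..n. (4 * real k ^ 2) / (4 * real k ^ 2 - 1)) = 16 ^ n * fact n ^ 4 / (fact (2 * n) ^ 2 * (2 * real n + 1))"
proof (induction n)
  case (Suc n)
  define a where "a = real n"
  have "0 \<le> a" by (simp add: a_def)
  have fact2: "fact (2 * Suc n) = (2 * a + 2) * (2 * a + 1) * (fact (2 * n) :: real)"
    by (simp add: a_def algebra_simps)
  have fact1: "fact (Suc n) = (a + 1) * (fact n :: real)"
    by (simp add: a_def algebra_simps)
  have factor: "4 * real (Suc n) ^ 2 / (4 * real (Suc n) ^ 2 - 1) = 4 * (a + 1) ^ 2 / ((2 * a + 1) * (2 * a + 3))"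
    by (simp add: a_def power2_eq_square algebra_simps)
  have "(\<Prod>k=1..Suc n. (4 * real k ^ 2) / (4 * real k ^ 2 - 1))
      = 16 ^ n * fact n ^ 4 / (fact (2 * n) ^ 2 * (2 * a + 1)) * (4 * (a + 1) ^ 2 / ((2 * a + 1) * (2 * a + 3)))"
    using Suc.IH unfolding prod.cl_ivl_Suc factor by (simp add: a_def)
  also have "\<dots> = 16 ^ Suc n * ((a + 1) * fact n) ^ 4 / (((2 * a + 2) * (2 * a + 1) * fact (2 * n)) ^ 2 * (2 * a + 3))"
  proof -
    have "2 * a + 2 = 2 * (a + 1)" by simp
    then show ?thesis
      using \<open>0 \<le> a\<close> by (simp add: power_mult_distrib divide_simps power2_eq_square power4_eq_xxxx)
        (simp add: algebra_simps)
  qed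
  finally show ?case
    unfolding fact1 fact2 by (simp add: a_def add.commute)
qed simp

text \<open>
  The sequence \<open>s(n) = ln n! + n - (n + 1/2) ln n\<close> decreases, because the midpoint rule underestimates
  the integral of \<open>1/x\<close> over \<open>[n, n + 1]\<close>, and so it stays above its limit. The trapezoidal rule bounds
  the decrements by the telescoping terms \<open>1/(4 n) - 1/(4 (n + 1))\<close>, so the limit \<open>L\<close> is finite.
  Wallis' product identifies it: \<open>4 s(n) - 2 s(2 n)\<close> tends to \<open>2 L\<close> and also to \<open>ln (2 \<pi>)\<close>.
\<close>

lemma stirling_lower_bound:
  assumes "1 \<le> n"
  shows "ln (sqrt (2 * pi)) \<le> ln (fact n) + real n - (real n + 1 / 2) * ln (real n)"
proof -
  define s where "s n = ln (fact n) + real n - (real n + 1 / 2) * ln (real n)" for n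
  have step: "s n - s (Suc n) = (real n + 1 / 2) * (ln (real n + 1) - ln (real n)) - 1" if "1 \<le> n" for n
  proof -
    have "ln (fact (Suc n) :: real) = ln (real n + 1) + ln (fact n)"
      by (simp add: ln_mult add.commute)
    then show ?thesis
      by (simp add: s_def algebra_simps del: fact_Suc)
  qed
  have decr: "s (Suc n) \<le> s n" if "1 \<le> n" for n
  proof -
    have "2 / (2 * real n + 1) \<le> ln (real n + 1) - ln (real n)"
      using ln_inverse_approx_ge[of "real n" "real n + 1"] that by simp
    then have "(real n + 1 / 2) * (2 / (2 * real n + 1)) \<le> (real n + 1 / 2) * (ln (real n + 1) - ln (real n))"
      by (intro mult_left_mono) auto
    also have "(real n + 1 / 2) * (2 / (2 * real n + 1)) = 1"
      by (simp add: divide_simps)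
    finally show ?thesis
      using step[OF that] by simp
  qed
  have incr: "s n - 1 / (4 * real n) \<le> s (Suc n) - 1 / (4 * real (Suc n))" if "1 \<le> n" for n
  proof -
    have "ln (real n + 1) - ln (real n) \<le> (inverse (real n) + inverse (real n + 1)) / 2"
      using ln_inverse_approx_le[of "real n" 1] that by simp
    then have "(real n + 1 / 2) * (ln (real n + 1) - ln (real n))
        \<le> (real n + 1 / 2) * ((inverse (real n) + inverse (real n + 1)) / 2)"
      by (intro mult_left_mono) auto
    also have "\<dots> = 1 + (1 / (4 * real n) - 1 / (4 * real (Suc n)))"
      using that by (simp add: divide_simps; simp add: algebra_simps)
    finally show ?thesis
      using step[OF that] by simp
  qed
  have dec: "decseq (\<lambda>n. s (Suc n))"
    by (rule decseq_SucI) (simp add: decr)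
  have "incseq (\<lambda>n. s (Suc n) - 1 / (4 * real (Suc n)))"
    by (rule incseq_SucI) (rule incr, simp)
  then have low: "s 1 - 1 / 4 \<le> s (Suc n) - 1 / (4 * real (Suc n))" for n
    using incseqD[of _ 0 n] by fastforce
  have "s 1 - 1 / 4 \<le> s (Suc n)" for n
  proof -
    have "0 \<le> 1 / (4 * real (Suc n))" by simp
    then show ?thesis using low[of n] by linarith
  qed
  then obtain L where "(\<lambda>n. s (Suc n)) \<longlonglongrightarrow> L" and ge: "\<And>n. L \<le> s (Suc n)"
    using decseq_convergent[OF dec] by metis
  then have L: "s \<longlonglongrightarrow> L"
    by (simp add: filterlim_sequentially_Suc)
  have "(\<lambda>n. 4 * s n - 2 * s (2 * n)) \<longlonglongrightarrow> 4 * L - 2 * L"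
    by (intro tendsto_intros L filterlim_compose[OF L]) (simp add: filterlim_subseq strict_mono_def)
  moreover
  have "(\<lambda>n. 4 * s n - 2 * s (2 * n)) \<longlonglongrightarrow> ln (pi / 2) + ln 2 + ln 2"
  proof (rule Lim_transform_eventually)
    have "(\<lambda>n. (2 * real n + 1) / real n) \<longlonglongrightarrow> 2"
    proof (rule Lim_transform_eventually)
      show "(\<lambda>n. 2 + 1 / real n) \<longlonglongrightarrow> 2"
        using tendsto_add[OF tendsto_const[of 2] lim_1_over_n] by simp
      show "\<forall>\<^sub>F n in sequentially. 2 + 1 / real n = (2 * real n + 1) / real n"
        using eventually_gt_at_top[of 0] by eventually_elim (simp add: field_simps)
    qed
    then show "(\<lambda>n. ln (\<Prod>k=1..n. (4 * real k ^ 2) / (4 * real k ^ 2 - 1))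
        + ln ((2 * real n + 1) / real n) + ln 2) \<longlonglongrightarrow> ln (pi / 2) + ln 2 + ln 2"
      by (intro tendsto_intros wallis) auto
    show "\<forall>\<^sub>F n in sequentially. ln (\<Prod>k=1..n. (4 * real k ^ 2) / (4 * real k ^ 2 - 1))
        + ln ((2 * real n + 1) / real n) + ln 2 = 4 * s n - 2 * s (2 * n)"
      using eventually_gt_at_top[of 0]
    proof eventually_elim
      case (elim n)
      have "ln (16 :: real) = 4 * ln 2"
        using ln_realpow[of 2 4] by simp
      then have "ln (16 ^ n * fact n ^ 4 / (fact (2 * n) ^ 2 * (2 * real n + 1)))
          = real n * (4 * ln 2) + 4 * ln (fact n) - 2 * ln (fact (2 * n)) - ln (2 * real n + 1)"
        by (simp add: ln_mult ln_div ln_realpow)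
      then show ?case
        unfolding wallis_product_closed_form
        using elim by (simp add: s_def ln_mult ln_div algebra_simps)
    qed
  qed
  ultimately have "4 * L - 2 * L = ln (pi / 2) + ln 2 + ln 2"
    by (rule LIMSEQ_unique)
  then have "L = ln (sqrt (2 * pi))"
    by (simp add: ln_sqrt ln_mult ln_div)
  with ge[of "n - 1"] assms show ?thesis
    by (simp add: s_def)
qed

text \<open>
  The quotients \<open>n\<^sup>n\<^sup>-\<^sup>1 / n!\<close> are the Taylor coefficients of the tree function, the inverse of
  \<open>z exp (- z)\<close>. They enter here because the scalar equation \<open>z' = z / (1 - z)\<close>, whose Carleman
  linearization is the majorant system, is solved by \<open>z exp (- z) = const exp t\<close>.
\<close>

lemma tree_coefficient_bound:
  assumes "1 \<le> n"
  shows "real n ^ (n - 1) / fact n \<le> exp (real n) * real n powr (- 3 / 2) / sqrt (2 * pi)"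
proof -
  have "ln (real n ^ (n - 1) / fact n) = (real n - 1) * ln (real n) - ln (fact n)"
    using assms by (simp add: ln_div ln_realpow of_nat_diff)
  also have "\<dots> \<le> real n + (- 3 / 2) * ln (real n) - ln (sqrt (2 * pi))"
    using stirling_lower_bound[OF assms] by (simp add: algebra_simps)
  also have "\<dots> = ln (exp (real n) * real n powr (- 3 / 2) / sqrt (2 * pi))"
    using assms by (simp add: ln_div ln_mult ln_powr)
  finally show ?thesis
    using assms by (subst (asm) ln_le_cancel_iff) auto
qed

section \<open>The majorant of a triangular system\<close>

text \<open>
  The eigenvector, normalised at \<open>k = N\<close>, for the eigenvalue \<open>N\<close> of the matrix with entry \<open>k\<close> at the
  places \<open>(k, l)\<close>, \<open>k \<le> l \<le> N\<close>, and \<open>0\<close> elsewhere.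
\<close>

definition majorant_coeff :: "nat \<Rightarrow> nat \<Rightarrow> real" where
  "majorant_coeff N k = real k * real N ^ (N - k) / (real N * fact (N - k))"

text \<open>
  Telescoping: with \<open>n = N - k \<ge> 1\<close>, the coefficient is the difference \<open>N\<^sup>n / n! - N\<^sup>n\<^sup>-\<^sup>1 / (n - 1)!\<close>.
  Multiplied by \<open>k\<close>, this is the eigenvector equation.
\<close>

lemma sum_majorant_coeff:
  assumes "k \<le> N" "1 \<le> N"
  shows "(\<Sum>l=k..N. majorant_coeff N l) = real N ^ (N - k) / fact (N - k)"
  using assms(1)
proof (induction rule: inc_induct)
  case base
  then show ?case
    using assms(2) by (simp add: majorant_coeff_def)
next
  case (step k)
  have "(\<Sum>l=k..N. majorant_coeff N l) = majorant_coeff N k + (\<Sum>l=Suc k..N. majorant_coeff N l)"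
    using step.hyps by (intro sum.atLeast_Suc_atMost) auto
  also have "\<dots> = majorant_coeff N k + real N ^ (N - Suc k) / fact (N - Suc k)"
    by (simp only: step.IH)
  also have "\<dots> = real N ^ (N - k) / fact (N - k)"
  proof -
    obtain m where m: "N = Suc (k + m)"
      using step.hyps by (metis less_iff_Suc_add)
    then have N: "real N \<noteq> 0" "real k = real N - real (Suc m)" "N - k = Suc m" "N - Suc k = m"
      by auto
    show ?thesis
      unfolding majorant_coeff_def N(3,4) N(2)
      using N(1) by (simp add: field_simps del: of_nat_Suc)
  qed
  finally show ?case .
qed

text \<open>
  The block of level \<open>k\<close> is driven by itself, by the higher levels and by a constant forcing \<open>C R\<^sup>k\<close>.
  Proceeding downwards from level \<open>N\<close>, the higher levels are already dominated, and each component
  obeys a scalar inequality. The dominating functions \<open>Y\<close> solve the majorant system with equality: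
  the term \<open>[k = N]\<close> absorbs the forcing, since adding \<open>C R\<^sup>N\<close> to the last level of a solution makes the
  system homogeneous, and the remaining exponential is an eigensolution.
\<close>

lemma triangular_system_bound:
  fixes e e' :: "real \<Rightarrow> 'i \<Rightarrow> 'a::real_normed_vector" and I :: "nat \<Rightarrow> 'i set"
  assumes deriv: "\<And>k \<alpha> s. k \<in> {1..N} \<Longrightarrow> \<alpha> \<in> I k \<Longrightarrow> s \<in> {0..T} \<Longrightarrow>
      ((\<lambda>s. e s \<alpha>) has_vector_derivative e' s \<alpha>) (at s within {0..T})"
    and init: "\<And>k \<alpha>. k \<in> {1..N} \<Longrightarrow> \<alpha> \<in> I k \<Longrightarrow> e 0 \<alpha> = 0"
    and bound: "\<And>k \<alpha> s U. k \<in> {1..N} \<Longrightarrow> \<alpha> \<in> I k \<Longrightarrow> s \<in> {0..T} \<Longrightarrow>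
      (\<And>l \<beta>. l \<in> {k<..N} \<Longrightarrow> \<beta> \<in> I l \<Longrightarrow> norm (e s \<beta>) \<le> U l) \<Longrightarrow>
      norm (e' s \<alpha>) \<le> real k * D * (norm (e s \<alpha>) + (\<Sum>l\<in>{k<..N}. U l / R ^ (l - k)) + C * R ^ k)"
    and pos: "0 \<le> D" "0 < R" "0 \<le> C"
    and k: "k \<in> {1..N}" and \<alpha>: "\<alpha> \<in> I k" and s: "s \<in> {0..T}"
  shows "norm (e s \<alpha>) \<le> C * R ^ k * majorant_coeff N k * exp (real N * D * s)"
proof -
  define Y where "Y k s = C * R ^ k * (majorant_coeff N k * exp (real N * D * s) - (if k = N then 1 else 0))"
    for k s
  have "norm (e s \<alpha>) \<le> Y k s" if "k \<in> {1..N}" "\<alpha> \<in> I k" "s \<in> {0..T}" for k \<alpha> s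
    using that
  proof (induction "N - k" arbitrary: k \<alpha> s rule: less_induct)
    case less
    define f where "f s = real k * D * ((\<Sum>l\<in>{k<..N}. Y l s / R ^ (l - k)) + C * R ^ k)" for s
    \<comment> \<open>Equality in the majorant system, written as a scalar equation for level k.\<close>
    have rhs: "real k * D * Y k s + f s = C * R ^ k * majorant_coeff N k * (real N * D * exp (real N * D * s))" for s
    proof -
      let ?E = "exp (real N * D * s)"
      have "Y k s + (\<Sum>l\<in>{k<..N}. Y l s / R ^ (l - k)) = (\<Sum>l=k..N. Y l s / R ^ (l - k))"
        using less.prems by (simp add: sum.head)
      also have "\<dots> = (\<Sum>l=k..N. C * R ^ k * (majorant_coeff N l * ?E - (if l = N then 1 else 0)))"
        using pos by (intro sum.cong) (auto simp: Y_def power_diff)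
      also have "\<dots> = C * R ^ k * ((\<Sum>l=k..N. majorant_coeff N l) * ?E - 1)"
        using less.prems by (simp add: sum_distrib_left[symmetric] sum_distrib_right sum_subtractf)
      also have "(\<Sum>l=k..N. majorant_coeff N l) = real N ^ (N - k) / fact (N - k)"
        using less.prems by (intro sum_majorant_coeff) auto
      finally have "Y k s + (\<Sum>l\<in>{k<..N}. Y l s / R ^ (l - k)) + C * R ^ k
          = C * R ^ k * (real N ^ (N - k) / fact (N - k) * ?E)"
        by (simp add: algebra_simps)
      moreover have "real k * D * Y k s + f s = real k * D * (Y k s + (\<Sum>l\<in>{k<..N}. Y l s / R ^ (l - k)) + C * R ^ k)"
        by (simp only: f_def distrib_left add.assoc)
      ultimately have "real k * D * Y k s + f s = real k * D * (C * R ^ k * (real N ^ (N - k) / fact (N - k) * ?E))"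
        by (simp only:)
      then show ?thesis
        using less.prems by (simp add: majorant_coeff_def)
    qed
    show ?case
    proof (rule linear_differential_inequality[where a = "real k * D" and f = f and T = T
          and \<phi> = "\<lambda>s. e s \<alpha>" and \<phi>' = "\<lambda>s. e' s \<alpha>" and Y = "Y k"])
      fix r assume r: "r \<in> {0..T}"
      show "((\<lambda>s. e s \<alpha>) has_vector_derivative e' r \<alpha>) (at r within {0..T})"
        by (rule deriv[OF less.prems(1,2) r])
      show "(Y k has_vector_derivative real k * D * Y k r + f r) (at r within {0..T})"
        unfolding rhs unfolding Y_def[abs_def] has_real_derivative_iff_has_vector_derivative[symmetric]
        by (auto intro!: derivative_eq_intros)
      have "norm (e' r \<alpha>) \<le> real k * D * (norm (e r \<alpha>) + (\<Sum>l\<in>{k<..N}. Y l r / R ^ (l - k)) + C * R ^ k)"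
        using less.prems by (intro bound r less.hyps) auto
      then show "norm (e' r \<alpha>) \<le> real k * D * norm (e r \<alpha>) + f r"
        by (simp only: f_def distrib_left add.assoc)
    next
      have "(if k = N then 1 else 0) \<le> majorant_coeff N k"
        using less.prems by (simp add: majorant_coeff_def)
      then show "norm (e 0 \<alpha>) \<le> Y k 0"
        using less.prems pos by (simp add: init Y_def)
    qed (use pos less.prems in auto)
  qed
  from this[OF k \<alpha> s] have "norm (e s \<alpha>) \<le> Y k s" .
  also have "\<dots> \<le> C * R ^ k * (majorant_coeff N k * exp (real N * D * s))"
    unfolding Y_def using pos by (intro mult_left_mono) auto
  finally show ?thesis by (simp add: mult.assoc)
qed

section \<open>Multi-indices and exponentials\<close>

lemma int_mabs:
  assumes "\<alpha> \<in> nonneg_idx"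
  shows "int (mabs \<alpha>) = (\<Sum>j\<in>UNIV. \<alpha> $ j)"
proof -
  have "(\<Sum>j\<in>UNIV. \<bar>\<alpha> $ j\<bar>) = (\<Sum>j\<in>UNIV. \<alpha> $ j)"
    using assms by (intro sum.cong) (auto simp: nonneg_idx_def)
  moreover have "0 \<le> (\<Sum>j\<in>UNIV. \<alpha> $ j)"
    using assms by (intro sum_nonneg) (auto simp: nonneg_idx_def)
  ultimately show ?thesis
    by (simp add: mabs_def)
qed

lemma nonneg_idx_add: "\<alpha> \<in> nonneg_idx \<Longrightarrow> \<gamma> \<in> nonneg_idx \<Longrightarrow> \<alpha> + \<gamma> \<in> nonneg_idx"
  by (simp add: nonneg_idx_def)

lemma mabs_add:
  assumes "\<alpha> \<in> nonneg_idx" "\<gamma> \<in> nonneg_idx"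
  shows "mabs (\<alpha> + \<gamma>) = mabs \<alpha> + mabs \<gamma>"
proof -
  have "int (mabs (\<alpha> + \<gamma>)) = int (mabs \<alpha>) + int (mabs \<gamma>)"
    using assms by (simp add: int_mabs nonneg_idx_add sum.distrib)
  then show ?thesis by linarith
qed

lemma nonneg_idx_deg_0: "nonneg_idx_deg 0 = {0}"
proof -
  have "\<alpha> = 0" if "\<alpha> \<in> nonneg_idx" "mabs \<alpha> = 0" for \<alpha> :: "int ^ 'd"
    using int_mabs[OF that(1)] that
    by (simp add: vec_eq_iff nonneg_idx_def sum_nonneg_eq_0_iff)
  then show ?thesis
    by (auto simp: nonneg_idx_deg_def nonneg_idx_def mabs_def)
qed

lemma axis_in_nonneg_idx_deg: "axis j 1 \<in> nonneg_idx_deg 1"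
  by (auto simp: nonneg_idx_deg_def nonneg_idx_def mabs_def axis_def if_distrib[of abs] cong: if_cong)

lemma idx_dot_axis: "idx_dot (axis j 1) z = z $ j"
proof -
  have "idx_dot (axis j 1) z = (\<Sum>i\<in>UNIV. if i = j then z $ i else 0)"
    unfolding idx_dot_def by (intro sum.cong) (auto simp: axis_def)
  then show ?thesis by simp
qed

lemma idx_dot_add_left: "idx_dot (\<alpha> + \<gamma>) z = idx_dot \<alpha> z + idx_dot \<gamma> z"
  by (simp add: idx_dot_def distrib_right sum.distrib)

lemma linear_idx_dot: "linear (idx_dot \<alpha>)"
  by (rule linearI)
    (simp_all add: idx_dot_def distrib_left sum.distrib scaleR_sum_right)

lemma bounded_linear_idx_dot: "bounded_linear (idx_dot \<alpha>)"
  by (rule linear_conv_bounded_linear[THEN iffD1, OF linear_idx_dot])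

lemma idx_dot_scale: "idx_dot \<alpha> (c *s z) = c * idx_dot \<alpha> z"
  by (simp add: idx_dot_def sum_distrib_left mult.left_commute)

text \<open>
  Because the components of \<open>\<alpha>\<close> are nonnegative and add up to \<open>k\<close>, the factor is the degree, with no
  dependence on the dimension; this is what makes the majorant system the scalar one.
\<close>

lemma norm_idx_dot_le:
  assumes "\<alpha> \<in> nonneg_idx_deg k"
  shows "norm (idx_dot \<alpha> z) \<le> real k * norm z"
proof -
  have \<alpha>: "\<alpha> \<in> nonneg_idx" "mabs \<alpha> = k"
    using assms by (auto simp: nonneg_idx_deg_def)
  have "norm (idx_dot \<alpha> z) \<le> (\<Sum>j\<in>UNIV. norm (of_int (\<alpha> $ j) * z $ j))"
    unfolding idx_dot_def by (rule norm_sum)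
  also have "\<dots> \<le> (\<Sum>j\<in>UNIV. real_of_int (\<alpha> $ j) * norm z)"
    using \<alpha>(1) by (intro sum_mono) (auto simp: norm_mult nonneg_idx_def intro!: mult_left_mono Finite_Cartesian_Product.norm_nth_le)
  also have "\<dots> = real_of_int (\<Sum>j\<in>UNIV. \<alpha> $ j) * norm z"
    by (simp add: sum_distrib_right)
  also have "\<dots> = real k * norm z"
    using int_mabs[OF \<alpha>(1)] \<alpha>(2) by (metis of_int_of_nat_eq)
  finally show ?thesis .
qed

lemma norm_exp_idx_dot_le:
  assumes "\<gamma> \<in> nonneg_idx" and m: "\<And>j. exp (- Im (z $ j)) \<le> m"
  shows "norm (exp (\<i> * idx_dot \<gamma> z)) \<le> m ^ mabs \<gamma>"
proof -
  have "0 < m"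
    using m exp_gt_zero less_le_trans by blast
  have "norm (exp (\<i> * idx_dot \<gamma> z)) = exp (\<Sum>j\<in>UNIV. real_of_int (\<gamma> $ j) * (- Im (z $ j)))"
    by (simp add: idx_dot_def sum_negf)
  also have "\<dots> \<le> exp (\<Sum>j\<in>UNIV. real_of_int (\<gamma> $ j) * ln m)"
  proof -
    have "- Im (z $ j) \<le> ln m" for j
      using m[of j] \<open>0 < m\<close> by (simp add: ln_ge_iff)
    then have "real_of_int (\<gamma> $ j) * (- Im (z $ j)) \<le> real_of_int (\<gamma> $ j) * ln m" for j
      using assms(1) by (intro mult_left_mono) (auto simp: nonneg_idx_def)
    then show ?thesis
      by (simp only: exp_le_cancel_iff sum_mono)
  qed
  also have "(\<Sum>j\<in>UNIV. real_of_int (\<gamma> $ j) * ln m) = real (mabs \<gamma>) * ln m"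
    using int_mabs[OF assms(1)]
    by (metis of_int_of_nat_eq of_int_sum sum_distrib_right)
  also have "exp \<dots> = m ^ mabs \<gamma>"
    using \<open>0 < m\<close> by (simp add: exp_of_nat_mult)
  finally show ?thesis .
qed

section \<open>Fourier series with geometrically decaying coefficients\<close>

text \<open>
  Every finite partial sum lies in a finite range of degrees, where the terms can be grouped by degree
  and compared with a geometric series; the bound survives the limit.
\<close>

lemma norm_has_sum_geometric_tail:
  fixes h :: "int ^ 'd::finite \<Rightarrow> 'b::real_normed_vector"
  assumes sum: "(h has_sum S) {\<gamma>. M \<le> mabs \<gamma>}"
    and deg: "\<And>l. (\<Sum>\<gamma>\<in>{\<gamma>. mabs \<gamma> = l}. norm (h \<gamma>)) \<le> D * q ^ l"
    and q: "0 \<le> q" "q < 1" and D: "0 \<le> D"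
  shows "norm S \<le> D * q ^ M / (1 - q)"
proof -
  have "norm (sum h F) \<le> D * q ^ M / (1 - q)" if F: "finite F" "F \<subseteq> {\<gamma>. M \<le> mabs \<gamma>}" for F
  proof -
    obtain L where L: "\<And>\<gamma>. \<gamma> \<in> F \<Longrightarrow> mabs \<gamma> < M + L"
    proof -
      have "finite (mabs ` F)" using F by simp
      then obtain L where "\<forall>n\<in>mabs ` F. n < L"
        using finite_nat_set_iff_bounded by blast
      then show thesis by (intro that[of L]) auto
    qed
    have "norm (sum h F) \<le> (\<Sum>\<gamma>\<in>F. norm (h \<gamma>))"
      by (rule norm_sum)
    also have "\<dots> \<le> (\<Sum>\<gamma>\<in>(\<Union>l\<in>{M..<M+L}. {\<gamma>. mabs \<gamma> = l}). norm (h \<gamma>))"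
      using F L by (intro sum_mono2) (auto simp: finite_mabs)
    also have "\<dots> = (\<Sum>l\<in>{M..<M+L}. \<Sum>\<gamma>\<in>{\<gamma>. mabs \<gamma> = l}. norm (h \<gamma>))"
      by (rule sum.UNION_disjoint) (auto simp: finite_mabs)
    also have "\<dots> \<le> (\<Sum>l\<in>{M..<M+L}. D * q ^ l)"
      by (intro sum_mono deg)
    also have "\<dots> = D * q ^ M * (\<Sum>l<L. q ^ l)"
      by (subst sum.shift_bounds_nat_ivl[of _ 0 M L, simplified add_0, unfolded add.commute[of L M]])
        (simp add: power_add sum_distrib_left atLeast0LessThan mult_ac)
    also have "\<dots> = D * q ^ M * ((1 - q ^ L) / (1 - q))"
      using q by (simp add: sum_gp_strict)
    also have "\<dots> \<le> D * q ^ M * (1 / (1 - q))"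
      using q D by (intro mult_left_mono divide_right_mono) auto
    finally show ?thesis by simp
  qed
  then have "\<forall>\<^sub>F F in finite_subsets_at_top {\<gamma>. M \<le> mabs \<gamma>}. norm (sum h F) \<le> D * q ^ M / (1 - q)"
    by (intro eventually_finite_subsets_at_top_weakI)
  with sum show ?thesis
    unfolding has_sum_def by (intro Lim_norm_ubound) auto
qed

text \<open>
  The coefficients of the vector field at one fixed time.
\<close>

locale decaying_coefficients =
  fixes c :: "int ^ 'd::finite \<Rightarrow> complex ^ 'd" and D R :: real
  assumes D_nonneg: "0 \<le> D" and R_pos: "0 < R"
    and support: "\<gamma> \<notin> nonneg_idx \<Longrightarrow> c \<gamma> = 0"
    and decay: "(\<Sum>\<gamma>\<in>{\<gamma>. mabs \<gamma> = k}. \<Sum>j\<in>UNIV. norm (c \<gamma> $ j)) \<le> D / R ^ k"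
begin

lemma sum_norm_coeff_le: "(\<Sum>\<gamma>\<in>{\<gamma>. mabs \<gamma> = k}. norm (c \<gamma>)) \<le> D / R ^ k"
proof -
  have "norm (c \<gamma>) \<le> (\<Sum>j\<in>UNIV. norm (c \<gamma> $ j))" for \<gamma>
    unfolding norm_vec_def by (rule L2_set_le_sum) simp
  then show ?thesis
    using decay[of k] by (meson order_trans sum_mono)
qed

lemma sum_nonneg_idx_deg_eq:
  fixes f :: "int ^ 'd \<Rightarrow> 'b::comm_monoid_add"
  assumes "\<And>\<gamma>. c \<gamma> = 0 \<Longrightarrow> f \<gamma> = 0"
  shows "(\<Sum>\<gamma>\<in>nonneg_idx_deg k. f \<gamma>) = (\<Sum>\<gamma>\<in>{\<gamma>. mabs \<gamma> = k}. f \<gamma>)"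
  using assms support
  by (intro sum.mono_neutral_left finite_mabs) (auto simp: nonneg_idx_deg_def)

text \<open>
  The growth \<open>(R q)\<^sup>l\<close> of the exponentials of degree \<open>l\<close> is beaten by the decay \<open>R\<^sup>-\<^sup>l\<close> of the
  coefficients.
\<close>

lemma sum_norm_terms_le:
  assumes z: "\<And>j. exp (- Im (z $ j)) \<le> R * q"
  shows "(\<Sum>\<gamma>\<in>{\<gamma>. mabs \<gamma> = l}. norm (exp (\<i> * idx_dot \<gamma> z) *s c \<gamma>)) \<le> D * q ^ l"
proof -
  have "0 < R * q"
    using z exp_gt_zero less_le_trans by blast
  have "(\<Sum>\<gamma>\<in>{\<gamma>. mabs \<gamma> = l}. norm (exp (\<i> * idx_dot \<gamma> z) *s c \<gamma>))
      \<le> (\<Sum>\<gamma>\<in>{\<gamma>. mabs \<gamma> = l}. (R * q) ^ l * norm (c \<gamma>))"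
  proof (rule sum_mono)
    fix \<gamma> :: "int ^ 'd" assume "\<gamma> \<in> {\<gamma>. mabs \<gamma> = l}"
    then have "norm (exp (\<i> * idx_dot \<gamma> z)) * norm (c \<gamma>) \<le> (R * q) ^ l * norm (c \<gamma>)"
      using norm_exp_idx_dot_le[OF _ z, of \<gamma>] support[of \<gamma>]
      by (cases "\<gamma> \<in> nonneg_idx") (auto intro: mult_right_mono)
    moreover have "norm (a *s y) = norm a * norm y" for a and y :: "complex ^ 'd"
      by (simp add: norm_vec_def norm_mult L2_set_right_distrib)
    ultimately show "norm (exp (\<i> * idx_dot \<gamma> z) *s c \<gamma>) \<le> (R * q) ^ l * norm (c \<gamma>)"
      by simp
  qed
  also have "\<dots> \<le> (R * q) ^ l * (D / R ^ l)"
    using sum_norm_coeff_le[of l] \<open>0 < R * q\<close>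
    by (simp add: sum_distrib_left[symmetric] del: times_divide_eq_right)
  also have "\<dots> = D * q ^ l"
    using R_pos by (simp add: power_mult_distrib)
  finally show ?thesis .
qed

text \<open>
  For \<open>M = 0\<close> this bounds the vector field itself, for \<open>M > 0\<close> its truncation error.
\<close>

lemma fourier_tail_bound:
  assumes sum: "((\<lambda>\<gamma>. exp (\<i> * idx_dot \<gamma> z) *s c \<gamma>) has_sum y) UNIV"
    and z: "\<And>j. exp (- Im (z $ j)) \<le> R * q" and "q < 1"
  shows "norm (y - (\<Sum>l<M. \<Sum>\<gamma>\<in>nonneg_idx_deg l. exp (\<i> * idx_dot \<gamma> z) *s c \<gamma>)) \<le> D * q ^ M / (1 - q)"
proof -
  let ?h = "\<lambda>\<gamma>. exp (\<i> * idx_dot \<gamma> z) *s c \<gamma>"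
  have "0 < R * q"
    using z exp_gt_zero less_le_trans by blast
  then have "0 \<le> q"
    using R_pos by (simp add: zero_less_mult_iff)
  have "{\<gamma> :: int ^ 'd. mabs \<gamma> < M} = (\<Union>l<M. {\<gamma>. mabs \<gamma> = l})"
    by auto
  then have "finite {\<gamma> :: int ^ 'd. mabs \<gamma> < M}"
    and head: "sum ?h {\<gamma>. mabs \<gamma> < M} = (\<Sum>l<M. \<Sum>\<gamma>\<in>{\<gamma>. mabs \<gamma> = l}. ?h \<gamma>)"
    by (simp_all add: finite_mabs) (rule sum.UNION_disjoint, auto simp: finite_mabs)
  then have "(?h has_sum (y - sum ?h {\<gamma>. mabs \<gamma> < M})) (UNIV - {\<gamma>. mabs \<gamma> < M})"
    by (intro has_sum_Diff sum has_sum_finite) auto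
  moreover have "UNIV - {\<gamma> :: int ^ 'd. mabs \<gamma> < M} = {\<gamma>. M \<le> mabs \<gamma>}"
    by auto
  ultimately have "norm (y - sum ?h {\<gamma>. mabs \<gamma> < M}) \<le> D * q ^ M / (1 - q)"
    using norm_has_sum_geometric_tail[OF _ sum_norm_terms_le[OF z] \<open>0 \<le> q\<close> \<open>q < 1\<close> D_nonneg]
    by simp
  moreover have "(\<Sum>\<gamma>\<in>{\<gamma>. mabs \<gamma> = l}. ?h \<gamma>) = (\<Sum>\<gamma>\<in>nonneg_idx_deg l. ?h \<gamma>)" for l
    by (rule sum_nonneg_idx_deg_eq[symmetric]) simp
  ultimately show ?thesis
    by (simp add: head)
qed

text \<open>
  Only columns \<open>\<beta>\<close> with \<open>\<beta> - \<alpha>\<close> in the nonnegative cone contribute, which makes the Carleman matrix block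
  upper triangular with diagonal blocks that are themselves diagonal.
\<close>

lemma carleman_row_shift:
  assumes \<alpha>: "\<alpha> \<in> nonneg_idx_deg k" and "k \<le> l"
  shows "(\<Sum>\<beta>\<in>nonneg_idx_deg l. \<i> * idx_dot \<alpha> (c (\<beta> - \<alpha>)) * u \<beta>)
    = (\<Sum>\<gamma>\<in>nonneg_idx_deg (l - k). \<i> * idx_dot \<alpha> (c \<gamma>) * u (\<alpha> + \<gamma>))"
proof -
  have "(\<Sum>\<beta>\<in>nonneg_idx_deg l. \<i> * idx_dot \<alpha> (c (\<beta> - \<alpha>)) * u \<beta>)
      = (\<Sum>\<beta>\<in>(+) \<alpha> ` nonneg_idx_deg (l - k). \<i> * idx_dot \<alpha> (c (\<beta> - \<alpha>)) * u \<beta>)"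
  proof (intro sum.mono_neutral_right finite_nonneg_idx_deg ballI)
    show "(+) \<alpha> ` nonneg_idx_deg (l - k) \<subseteq> nonneg_idx_deg l"
      using assms by (auto simp: nonneg_idx_deg_def nonneg_idx_add mabs_add)
    fix \<beta> assume \<beta>: "\<beta> \<in> nonneg_idx_deg l - (+) \<alpha> ` nonneg_idx_deg (l - k)"
    have "\<beta> - \<alpha> \<notin> nonneg_idx"
    proof
      assume diff: "\<beta> - \<alpha> \<in> nonneg_idx"
      then have "mabs \<beta> = mabs \<alpha> + mabs (\<beta> - \<alpha>)"
        using \<alpha> mabs_add[of \<alpha> "\<beta> - \<alpha>"] by (auto simp: nonneg_idx_deg_def)
      then have "\<beta> - \<alpha> \<in> nonneg_idx_deg (l - k)"
        using \<alpha> \<beta> diff by (auto simp: nonneg_idx_deg_def)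
      then show False
        using \<beta> by (metis DiffE add_diff_cancel_left' diff_add_cancel image_eqI add.commute)
    qed
    then show "\<i> * idx_dot \<alpha> (c (\<beta> - \<alpha>)) * u \<beta> = 0"
      by (simp add: support idx_dot_def)
  qed
  also have "\<dots> = (\<Sum>\<gamma>\<in>nonneg_idx_deg (l - k). \<i> * idx_dot \<alpha> (c \<gamma>) * u (\<alpha> + \<gamma>))"
    by (subst sum.reindex) auto
  finally show ?thesis .
qed

lemma carleman_block_row_bound:
  assumes \<alpha>: "\<alpha> \<in> nonneg_idx_deg k" and "k \<le> l"
    and u: "\<And>\<gamma>. \<gamma> \<in> nonneg_idx_deg (l - k) \<Longrightarrow> norm (u (\<alpha> + \<gamma>)) \<le> U"
  shows "norm (\<Sum>\<beta>\<in>nonneg_idx_deg l. \<i> * idx_dot \<alpha> (c (\<beta> - \<alpha>)) * u \<beta>) \<le> real k * D * (U / R ^ (l - k))"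
proof -
  have "nonneg_idx_deg (l - k) \<noteq> ({} :: (int ^ 'd) set)"
  proof -
    \<comment> \<open>Any multi-index of degree l - k shows that U bounds a norm, hence is nonnegative.\<close>
    have "axis undefined (int (l - k)) \<in> (nonneg_idx_deg (l - k) :: (int ^ 'd) set)"
      by (auto simp: nonneg_idx_deg_def nonneg_idx_def mabs_def axis_def if_distrib[of abs] cong: if_cong)
    then show ?thesis by blast
  qed
  then have "0 \<le> U"
    using u norm_ge_zero order_trans by blast
  have "norm (\<Sum>\<beta>\<in>nonneg_idx_deg l. \<i> * idx_dot \<alpha> (c (\<beta> - \<alpha>)) * u \<beta>)
      \<le> (\<Sum>\<gamma>\<in>nonneg_idx_deg (l - k). norm (\<i> * idx_dot \<alpha> (c \<gamma>) * u (\<alpha> + \<gamma>)))"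
    unfolding carleman_row_shift[OF \<alpha> \<open>k \<le> l\<close>] by (rule norm_sum)
  also have "\<dots> \<le> (\<Sum>\<gamma>\<in>nonneg_idx_deg (l - k). real k * norm (c \<gamma>) * U)"
    using norm_idx_dot_le[OF \<alpha>] u by (intro sum_mono) (auto simp: norm_mult intro!: mult_mono)
  also have "\<dots> = real k * U * (\<Sum>\<gamma>\<in>nonneg_idx_deg (l - k). norm (c \<gamma>))"
    by (simp add: sum_distrib_left mult_ac)
  also have "(\<Sum>\<gamma>\<in>nonneg_idx_deg (l - k). norm (c \<gamma>)) = (\<Sum>\<gamma>\<in>{\<gamma>. mabs \<gamma> = l - k}. norm (c \<gamma>))"
    by (rule sum_nonneg_idx_deg_eq) simp
  also have "real k * U * \<dots> \<le> real k * U * (D / R ^ (l - k))"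
    using sum_norm_coeff_le \<open>0 \<le> U\<close> by (intro mult_left_mono) auto
  finally show ?thesis by (simp add: mult_ac)
qed

text \<open>
  Since \<open>exp (\<i> (\<alpha> + \<gamma>) z) = exp (\<i> \<alpha> z) exp (\<i> \<gamma> z)\<close>, the row of the finite section applied to the
  exponentials is \<open>exp (\<i> \<alpha> z)\<close> times the partial Fourier sum of degrees at most \<open>N - k\<close>. What is missing
  is the tail, of size \<open>q\<^sup>N\<^sup>-\<^sup>k\<^sup>+\<^sup>1 / (1 - q)\<close>, and the factor \<open>\<bar>exp (\<i> \<alpha> z)\<bar> \<le> R\<^sup>k q\<^sup>k\<close> restores
  the exponent \<open>N + 1\<close> for all rows alike.
\<close>

lemma carleman_truncation_defect:
  assumes \<alpha>: "\<alpha> \<in> nonneg_idx_deg k" and "k \<le> N"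
    and sum: "((\<lambda>\<gamma>. exp (\<i> * idx_dot \<gamma> z) *s c \<gamma>) has_sum y) UNIV"
    and z: "\<And>j. exp (- Im (z $ j)) \<le> R * q" and "q < 1"
  shows "norm ((\<Sum>l=k..N. \<Sum>\<beta>\<in>nonneg_idx_deg l. \<i> * idx_dot \<alpha> (c (\<beta> - \<alpha>)) * exp (\<i> * idx_dot \<beta> z))
      - \<i> * idx_dot \<alpha> y * exp (\<i> * idx_dot \<alpha> z)) \<le> real k * D * (R ^ k * (q ^ Suc N / (1 - q)))"
proof -
  let ?w = "\<lambda>\<beta>. exp (\<i> * idx_dot \<beta> z)"
  let ?S = "\<Sum>m<Suc (N - k). \<Sum>\<gamma>\<in>nonneg_idx_deg m. ?w \<gamma> *s c \<gamma>"
  have "0 < R * q"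
    using z exp_gt_zero less_le_trans by blast
  then have "0 \<le> q"
    using R_pos by (simp add: zero_less_mult_iff)
  interpret L: bounded_linear "idx_dot \<alpha>"
    by (rule bounded_linear_idx_dot)
  have "(\<Sum>l=k..N. \<Sum>\<beta>\<in>nonneg_idx_deg l. \<i> * idx_dot \<alpha> (c (\<beta> - \<alpha>)) * ?w \<beta>)
      = (\<Sum>l=k..N. \<Sum>\<gamma>\<in>nonneg_idx_deg (l - k). \<i> * idx_dot \<alpha> (c \<gamma>) * ?w (\<alpha> + \<gamma>))"
    by (intro sum.cong refl carleman_row_shift[OF \<alpha>]) simp
  also have "\<dots> = (\<Sum>m<Suc (N - k). \<Sum>\<gamma>\<in>nonneg_idx_deg m. \<i> * idx_dot \<alpha> (c \<gamma>) * ?w (\<alpha> + \<gamma>))"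
    using \<open>k \<le> N\<close>
    by (intro sum.reindex_bij_witness[where i = "\<lambda>m. m + k" and j = "\<lambda>l. l - k"]) auto
  also have "\<dots> = (\<Sum>m<Suc (N - k). \<Sum>\<gamma>\<in>nonneg_idx_deg m. \<i> * ?w \<alpha> * idx_dot \<alpha> (?w \<gamma> *s c \<gamma>))"
    by (intro sum.cong refl) (simp add: idx_dot_scale idx_dot_add_left distrib_left exp_add)
  also have "\<dots> = \<i> * ?w \<alpha> * idx_dot \<alpha> ?S"
    by (simp only: L.sum sum_distrib_left)
  finally have "(\<Sum>l=k..N. \<Sum>\<beta>\<in>nonneg_idx_deg l. \<i> * idx_dot \<alpha> (c (\<beta> - \<alpha>)) * ?w \<beta>)
      - \<i> * idx_dot \<alpha> y * ?w \<alpha> = - (\<i> * ?w \<alpha> * idx_dot \<alpha> (y - ?S))"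
    unfolding L.diff by (simp only: right_diff_distrib minus_diff_eq mult_ac)
  then have "norm ((\<Sum>l=k..N. \<Sum>\<beta>\<in>nonneg_idx_deg l. \<i> * idx_dot \<alpha> (c (\<beta> - \<alpha>)) * ?w \<beta>)
      - \<i> * idx_dot \<alpha> y * ?w \<alpha>) = norm (?w \<alpha>) * norm (idx_dot \<alpha> (y - ?S))"
    by (simp only: norm_minus_cancel norm_mult norm_ii mult_1_left)
  also have "\<dots> \<le> (R * q) ^ k * (real k * (D * q ^ Suc (N - k) / (1 - q)))"
  proof (intro mult_mono)
    show "norm (?w \<alpha>) \<le> (R * q) ^ k"
      using norm_exp_idx_dot_le[OF _ z, of \<alpha>] \<alpha> by (auto simp: nonneg_idx_deg_def)
    show "norm (idx_dot \<alpha> (y - ?S)) \<le> real k * (D * q ^ Suc (N - k) / (1 - q))"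
      using norm_idx_dot_le[OF \<alpha>, of "y - ?S"] fourier_tail_bound[OF sum z \<open>q < 1\<close>, of "Suc (N - k)"]
      by (meson mult_left_mono of_nat_0_le_iff order_trans)
  qed (use \<open>0 < R * q\<close> in auto)
  also have "\<dots> = real k * D * (R ^ k * (q ^ k * q ^ Suc (N - k) / (1 - q)))"
    by (simp add: power_mult_distrib mult_ac)
  also have "q ^ k * q ^ Suc (N - k) = q ^ Suc N"
    using \<open>k \<le> N\<close> by (simp flip: power_add)
  finally show ?thesis .
qed

end

section \<open>The error of the finite section\<close>

text \<open>
  The error \<open>v\<^sub>\<alpha> - exp (\<i> \<alpha> x)\<close> is zero initially, and its derivative is the row of the finite section
  applied to the error plus the truncation defect. Bounding the row block by block yields the
  hypothesis of \<open>triangular_system_bound\<close> with \<open>C = q\<^sup>N\<^sup>+\<^sup>1 / (1 - q)\<close>.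
\<close>

lemma finite_section_error_bound:
  fixes x :: "real \<Rightarrow> complex ^ 'd::finite"
  assumes coeff: "\<And>s. 0 \<le> s \<Longrightarrow> decaying_coefficients (G s) D R"
    and x: "\<And>s. s \<in> {0..t} \<Longrightarrow> (x has_vector_derivative y s) (at s within {0..t})"
    and y: "\<And>s. s \<in> {0..t} \<Longrightarrow> ((\<lambda>\<gamma>. exp (\<i> * idx_dot \<gamma> (x s)) *s G s \<gamma>) has_sum y s) UNIV"
    and q: "\<And>s j. s \<in> {0..t} \<Longrightarrow> exp (- Im (x s $ j)) \<le> R * q" "0 \<le> q" "q < 1"
    and v: "finite_section_solution G (x 0) N {0..t} v"
    and k: "k \<in> {1..N}" and \<alpha>: "\<alpha> \<in> nonneg_idx_deg k" and "0 \<le> t"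
  shows "norm (v t \<alpha> - exp (\<i> * idx_dot \<alpha> (x t)))
    \<le> q ^ Suc N / (1 - q) * R ^ k * majorant_coeff N k * exp (real N * D * t)"
proof (rule triangular_system_bound[where I = nonneg_idx_deg and T = t, OF _ _ _ _ _ _ k \<alpha>])
  define w where "w s \<beta> = exp (\<i> * idx_dot \<beta> (x s))" for s \<beta>
  let ?row = "\<lambda>k \<alpha> s u. \<Sum>l=k..N. \<Sum>\<beta>\<in>nonneg_idx_deg l. carleman_entry G s \<alpha> \<beta> * u \<beta>"
  fix k and \<alpha> :: "int ^ 'd" assume k: "k \<in> {1..N}" and \<alpha>: "\<alpha> \<in> nonneg_idx_deg k"
  then have mabs: "mabs \<alpha> = k" by (simp add: nonneg_idx_deg_def)
  show "v 0 \<alpha> - exp (\<i> * idx_dot \<alpha> (x 0)) = 0"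
    using v k \<alpha> by (simp add: finite_section_solution_def)
  fix s assume s: "s \<in> {0..t}"
  interpret decaying_coefficients "G s" D R
    using coeff s by simp
  have "((\<lambda>s. v s \<alpha>) has_vector_derivative ?row k \<alpha> s (v s)) (at s within {0..t})"
    using v k \<alpha> s by (simp add: finite_section_solution_def)
  moreover have "((\<lambda>s. w s \<alpha>) has_vector_derivative \<i> * idx_dot \<alpha> (y s) * w s \<alpha>) (at s within {0..t})"
  proof -
    have "bounded_linear (\<lambda>z. \<i> * idx_dot \<alpha> z)"
      by (intro bounded_linear_mult_right[THEN bounded_linear_compose] bounded_linear_idx_dot)
    from bounded_linear.has_vector_derivative[OF this x[OF s]]
    have "((\<lambda>s. \<i> * idx_dot \<alpha> (x s)) has_vector_derivative \<i> * idx_dot \<alpha> (y s)) (at s within {0..t})" .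
    from field_vector_diff_chain_within[OF this, of exp] show ?thesis
      unfolding w_def[abs_def] o_def by (simp add: DERIV_exp has_field_derivative_at_within)
  qed
  ultimately
  show "((\<lambda>s. v s \<alpha> - exp (\<i> * idx_dot \<alpha> (x s))) has_vector_derivative
      ?row (mabs \<alpha>) \<alpha> s (v s) - \<i> * idx_dot \<alpha> (y s) * exp (\<i> * idx_dot \<alpha> (x s))) (at s within {0..t})"
    unfolding mabs w_def by (rule has_vector_derivative_diff)
  fix U :: "nat \<Rightarrow> real"
  assume U: "\<And>l \<beta>. l \<in> {k<..N} \<Longrightarrow> \<beta> \<in> nonneg_idx_deg l \<Longrightarrow>
      norm (v s \<beta> - exp (\<i> * idx_dot \<beta> (x s))) \<le> U l"
  let ?e = "\<lambda>\<beta>. v s \<beta> - w s \<beta>"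
  \<comment> \<open>In the diagonal block only the error at \<open>\<alpha>\<close> itself occurs, which closes the scalar inequality for \<open>\<alpha>\<close>.\<close>
  let ?V = "\<lambda>l. if l = k then norm (?e \<alpha>) else U l"
  have "norm (?row k \<alpha> s ?e) \<le> (\<Sum>l=k..N. real k * D * (?V l / R ^ (l - k)))"
  proof (rule sum_norm_le)
    fix l assume l: "l \<in> {k..N}"
    show "norm (\<Sum>\<beta>\<in>nonneg_idx_deg l. carleman_entry G s \<alpha> \<beta> * ?e \<beta>) \<le> real k * D * (?V l / R ^ (l - k))"
      unfolding carleman_entry_def
    proof (rule carleman_block_row_bound[OF \<alpha>])
      fix \<gamma> :: "int ^ 'd" assume \<gamma>: "\<gamma> \<in> nonneg_idx_deg (l - k)"
      then have "\<alpha> + \<gamma> \<in> nonneg_idx_deg l"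
        using \<alpha> l by (auto simp: nonneg_idx_deg_def nonneg_idx_add mabs_add)
      then show "norm (?e (\<alpha> + \<gamma>)) \<le> ?V l"
        using \<gamma> l U[of l "\<alpha> + \<gamma>"] by (auto simp: nonneg_idx_deg_0 w_def)
    qed (use l in auto)
  qed
  also have "\<dots> = real k * D * (norm (?e \<alpha>) + (\<Sum>l\<in>{k<..N}. U l / R ^ (l - k)))"
    using k by (simp add: sum.head distrib_left sum_distrib_left)
  finally have rows: "norm (?row k \<alpha> s ?e) \<le> \<dots>" .
  have defect: "norm (?row k \<alpha> s (w s) - \<i> * idx_dot \<alpha> (y s) * w s \<alpha>)
      \<le> real k * D * (R ^ k * (q ^ Suc N / (1 - q)))"
    unfolding w_def carleman_entry_def
    by (rule carleman_truncation_defect) (use k \<alpha> s y q in auto)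
  have "?row k \<alpha> s (v s) = ?row k \<alpha> s ?e + ?row k \<alpha> s (w s)"
    by (simp add: sum.distrib[symmetric] right_diff_distrib)
  then have "?row k \<alpha> s (v s) - \<i> * idx_dot \<alpha> (y s) * w s \<alpha>
      = ?row k \<alpha> s ?e + (?row k \<alpha> s (w s) - \<i> * idx_dot \<alpha> (y s) * w s \<alpha>)"
    by (simp only: add_diff_eq)
  then have "norm (?row k \<alpha> s (v s) - \<i> * idx_dot \<alpha> (y s) * w s \<alpha>)
      \<le> real k * D * (norm (?e \<alpha>) + (\<Sum>l\<in>{k<..N}. U l / R ^ (l - k)))
        + real k * D * (R ^ k * (q ^ Suc N / (1 - q)))"
    using norm_triangle_mono[OF rows defect] by (simp only:)
  also have "\<dots> = real k * D * (norm (?e \<alpha>) + (\<Sum>l\<in>{k<..N}. U l / R ^ (l - k)) + q ^ Suc N / (1 - q) * R ^ k)"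
    by (simp only: distrib_left mult.commute[of "R ^ k"])
  finally show "norm (?row (mabs \<alpha>) \<alpha> s (v s) - \<i> * idx_dot \<alpha> (y s) * exp (\<i> * idx_dot \<alpha> (x s)))
      \<le> real k * D * (norm (v s \<alpha> - exp (\<i> * idx_dot \<alpha> (x s)))
        + (\<Sum>l\<in>{k<..N}. U l / R ^ (l - k)) + q ^ Suc N / (1 - q) * R ^ k)"
    unfolding mabs w_def .
next
  interpret decaying_coefficients "G 0" D R
    using coeff by simp
  show "0 \<le> D" "0 < R" by (rule D_nonneg R_pos)+
qed (use q \<open>0 \<le> t\<close> in auto)

theorem theorem3p1:
  fixes D0 R :: real
    and g :: "real \<Rightarrow> complex ^ 'd::finite \<Rightarrow> complex ^ 'd"
    and G :: "real \<Rightarrow> int ^ 'd \<Rightarrow> complex ^ 'd"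
    and x :: "real \<Rightarrow> complex ^ 'd" and x0 :: "complex ^ 'd"
    and N :: nat and v :: "real \<Rightarrow> int ^ 'd \<Rightarrow> complex"
  assumes "D0 > 0" and "R > 0"
    and "periodic_field g"
    and "has_Fourier_expansion g G R"
    and "\<And>t \<alpha>. t \<ge> 0 \<Longrightarrow> \<alpha> \<notin> nonneg_idx \<Longrightarrow> G t \<alpha> = 0"
    and "\<And>t k. t \<ge> 0 \<Longrightarrow> (\<Sum>\<alpha>\<in>{\<alpha>. mabs \<alpha> = k}. \<Sum>j\<in>UNIV. norm (G t \<alpha> $ j)) \<le> D0 / R ^ k"
    and "max_norm (exp_i x0) < exp (-1) * R"
    and "solves_ivp g x0 {0..T_CF D0 R x0} x"
    and "N \<ge> 1"
    and "finite_section_solution G x0 N {0..T_CF D0 R x0} v"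
  shows "T_CF D0 R x0 > 0 \<and>
    (\<forall>t. 0 \<le> t \<and> t \<le> T_CF D0 R x0 \<longrightarrow>
      Max (range (\<lambda>j. norm (v t (axis j 1) * exp (- \<i> * x t $ j) - 1)))
        \<le> C_0 R x0 * real N powr (- 3 / 2) * exp (D0 * t * real N)
          * (exp 1 * max_norm (exp_i x0) / R) powr ((exp 1 - 1) * real N / (2 * exp 1 - 1)))"
proof -
  define E :: real where "E = exp 1"
  define T where "T = T_CF D0 R x0"
  define m where "m = max_norm (exp_i x0)"
  \<comment> \<open>\<open>\<Lambda>\<close> is the distance to the region where some \<open>\<bar>exp (\<i> x\<^sub>j)\<bar>\<close> exceeds \<open>R / e\<close>; \<open>K\<close> bounds the speed outside it.\<close>
  define \<Lambda> where "\<Lambda> = ln R - ln m - 1"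
  define K where "K = D0 * E / (E - 1)"
  have "1 < E" by (simp add: E_def)
  then have E: "0 < E - 1" "0 < 2 * E - 1" by auto
  have "0 < m" by (simp add: m_def max_norm_exp_i)
  have "m < exp (-1) * R" using assms(7) by (simp add: m_def)
  then have "ln m < ln (exp (-1) * R)"
    using \<open>0 < m\<close> \<open>R > 0\<close> by (intro ln_less_cancel_iff[THEN iffD2]) auto
  then have "0 < \<Lambda>"
    using \<open>R > 0\<close> by (simp add: \<Lambda>_def ln_mult)
  have m_eq: "m = R * exp (-1) * exp (- \<Lambda>)"
  proof -
    have "m = exp (ln R + - 1 + - \<Lambda>)"
      using \<open>0 < m\<close> by (simp add: \<Lambda>_def)
    then show ?thesis
      using \<open>R > 0\<close> by (simp only: exp_add exp_ln)
  qed
  have T_eq: "T = (E - 1) / (D0 * (2 * E - 1)) * \<Lambda>"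
    by (simp add: T_def T_CF_def E_def m_def \<Lambda>_def)
  have "0 < T"
    unfolding T_eq using E \<open>D0 > 0\<close> \<open>0 < \<Lambda>\<close> by simp
  have "0 \<le> K"
    using E \<open>1 < E\<close> \<open>D0 > 0\<close> by (simp add: K_def)
  have KT: "K * T = E / (2 * E - 1) * \<Lambda>"
    unfolding K_def T_eq using E \<open>D0 > 0\<close> by (simp add: divide_simps)
  have "E / (2 * E - 1) < 1"
    using E by (simp add: divide_simps)
  then have room: "K * T < \<Lambda>"
    unfolding KT using \<open>0 < \<Lambda>\<close> mult_strict_right_mono[of "E / (2 * E - 1)" 1 \<Lambda>] by simp

  have coeff: "decaying_coefficients (G s) D0 R" if "0 \<le> s" for s
    by unfold_locales (use assms that in auto)
  have x_init: "x 0 = x0" and x_deriv: "\<And>s. s \<in> {0..T} \<Longrightarrow> (x has_vector_derivative g s (x s)) (at s within {0..T})"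
    using assms(8) by (auto simp: solves_ivp_def T_def)
  have Im0: "exp (- Im (x0 $ j)) \<le> m" for j
    unfolding m_def max_norm_exp_i by (simp add: Min_le)
  have height: "exp (- Im (z $ j)) \<le> m * exp b" if "norm (z - x0) \<le> b" for z j b
  proof -
    have "\<bar>Im (z $ j - x0 $ j)\<bar> \<le> norm (z - x0)"
      using abs_Im_le_cmod[of "z $ j - x0 $ j"] Finite_Cartesian_Product.norm_nth_le[of "z - x0" j] by simp
    then have "exp (- Im (z $ j)) \<le> exp (- Im (x0 $ j)) * exp b"
      using that by (simp flip: exp_add)
    also have "\<dots> \<le> m * exp b"
      using Im0 by (intro mult_right_mono) auto
    finally show ?thesis .
  qed
  have expansion: "((\<lambda>\<gamma>. exp (\<i> * idx_dot \<gamma> z) *s G s \<gamma>) has_sum g s z) UNIV"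
    and region: "\<And>j. exp (- Im (z $ j)) \<le> R * exp (-1)"
    if "0 \<le> s" "norm (z - x0) \<le> \<Lambda>" for s z
  proof -
    show le: "exp (- Im (z $ j)) \<le> R * exp (-1)" for j
      using height[OF that(2), of j] unfolding m_eq by (simp add: mult.assoc flip: exp_add)
    have "- ln R < Im (z $ j)" for j
    proof -
      have "exp (- Im (z $ j)) < R"
        using le[of j] \<open>R > 0\<close> by (smt (verit) exp_less_one_iff mult_less_cancel_left2)
      then have "- Im (z $ j) < ln R"
        using \<open>R > 0\<close> by (metis exp_less_cancel_iff exp_ln)
      then show ?thesis by simp
    qed
    then show "((\<lambda>\<gamma>. exp (\<i> * idx_dot \<gamma> z) *s G s \<gamma>) has_sum g s z) UNIV"
      using assms(4) that(1) unfolding has_Fourier_expansion_def by blast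
  qed
  have speed: "norm (g s z) \<le> K" if "0 \<le> s" "norm (z - x0) \<le> \<Lambda>" for s z
  proof -
    interpret decaying_coefficients "G s" D0 R
      using coeff that by simp
    have "norm (g s z) \<le> D0 / (1 - exp (-1))"
      using fourier_tail_bound[OF expansion[OF that] region[OF that], of 0] by simp
    also have "\<dots> = K"
      using E by (simp add: K_def E_def exp_minus divide_simps)
    finally show ?thesis .
  qed
  have near: "norm (x s - x0) \<le> K * s" if "s \<in> {0..T}" for s
    using norm_le_barrier[OF x_deriv room \<open>0 \<le> K\<close> _ that] speed by (simp add: x_init)

  have main: "norm (v t (axis j 1) * exp (- \<i> * x t $ j) - 1)
      \<le> C_0 R x0 * real N powr (- 3 / 2) * exp (D0 * t * real N)
          * (E * m / R) powr ((E - 1) * real N / (2 * E - 1))"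
    if t: "0 \<le> t" "t \<le> T" for t j
  proof -
    \<comment> \<open>Fixing the final time t makes the forcing of the error system constant on [0, t].\<close>
    define q where "q = m / R * exp (K * t)"
    have "K * t \<le> K * T"
      using t \<open>0 \<le> K\<close> by (intro mult_left_mono)
    have q_eq: "q = exp (- 1 - \<Lambda> + K * t)"
      unfolding q_def m_eq using \<open>R > 0\<close> by (simp add: exp_diff exp_add exp_minus divide_simps)
    then have "0 < q" and q1: "q \<le> exp (-1)"
      using room \<open>K * t \<le> K * T\<close> by auto
    then have "q < 1"
      by (smt (verit) exp_less_one_iff)
    have sub: "{0..t} \<subseteq> {0..T}"
      using t by auto
    have "norm (v t (axis j 1) - exp (\<i> * idx_dot (axis j 1) (x t)))
        \<le> q ^ Suc N / (1 - q) * R ^ 1 * majorant_coeff N 1 * exp (real N * D0 * t)"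
    proof (rule finite_section_error_bound[OF coeff, where y = "\<lambda>s. g s (x s)"])
      fix s assume s: "s \<in> {0..t}"
      then have sT: "s \<in> {0..T}" and "K * s \<le> K * t"
        using sub \<open>0 \<le> K\<close> by (auto intro: mult_left_mono)
      then have "norm (x s - x0) \<le> K * t"
        using near by fastforce
      then show "exp (- Im (x s $ j)) \<le> R * q" for j
        using height[of "x s" "K * t" j] \<open>R > 0\<close> by (simp add: q_def)
      show "(x has_vector_derivative g s (x s)) (at s within {0..t})"
        using x_deriv[OF sT] sub by (rule has_vector_derivative_within_subset)
      show "((\<lambda>\<gamma>. exp (\<i> * idx_dot \<gamma> (x s)) *s G s \<gamma>) has_sum g s (x s)) UNIV"
        using expansion s \<open>norm (x s - x0) \<le> K * t\<close> \<open>K * t \<le> K * T\<close> room by simp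
    next
      show "finite_section_solution G (x 0) N {0..t} v"
        using assms(10) sub unfolding finite_section_solution_def x_init T_def[symmetric]
        by (blast intro: has_vector_derivative_within_subset)
    qed (use t \<open>0 < q\<close> \<open>q < 1\<close> \<open>N \<ge> 1\<close> axis_in_nonneg_idx_deg in auto)
    then have err: "norm (v t (axis j 1) - exp (\<i> * x t $ j))
        \<le> q ^ Suc N / (1 - q) * R * majorant_coeff N 1 * exp (real N * D0 * t)"
      by (simp only: idx_dot_axis power_one_right)

    have tail: "q ^ Suc N / (1 - q) \<le> q ^ N / (E - 1)"
    proof -
      have "q * E \<le> 1"
        using q1 mult_right_mono[of q "exp (-1)" E] \<open>1 < E\<close> by (simp add: E_def exp_minus)
      then have "q / (1 - q) \<le> 1 / (E - 1)"
        using E \<open>q < 1\<close> by (simp add: divide_simps algebra_simps)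
      from mult_left_mono[OF this, of "q ^ N"] show ?thesis
        using \<open>0 < q\<close> by (simp add: mult.commute)
    qed
    have coef: "majorant_coeff N 1 \<le> exp (real N) * real N powr (- 3 / 2) / sqrt (2 * pi)"
    proof -
      have "fact N = real N * fact (N - 1)"
        using \<open>N \<ge> 1\<close> by (simp add: fact_reduce)
      then show ?thesis
        using tree_coefficient_bound[OF \<open>N \<ge> 1\<close>] by (simp add: majorant_coeff_def)
    qed
    have Im_j: "R * exp (Im (x t $ j)) \<le> exp ((3 * E - 1) / (2 * E - 1) * max_Im x0
        + (3 * E - 1) / (2 * E - 1) * ln R - E / (2 * E - 1))"
    proof -
      define P where "P = max_Im x0 + ln R"
      have max_Im: "Im (x0 $ i) \<le> max_Im x0" for i
        by (simp add: max_Im_def Max_ge)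
      have "Im (x t $ j - x0 $ j) \<le> norm (x t - x0)"
        using abs_Im_le_cmod[of "x t $ j - x0 $ j"] Finite_Cartesian_Product.norm_nth_le[of "x t - x0" j] by simp
      then have "Im (x t $ j) \<le> max_Im x0 + K * T"
        using near[of t] t max_Im[of j] \<open>K * t \<le> K * T\<close> by simp
      \<comment> \<open>Bounding the smallest imaginary part, which enters \<open>\<Lambda>\<close>, by the largest leaves only the latter in the constant.\<close>
      moreover have "\<Lambda> \<le> P - 1"
      proof -
        have "exp (- max_Im x0) \<le> exp (- Im (x0 $ j))"
          using max_Im[of j] by simp
        also have "\<dots> \<le> m" by (rule Im0)
        finally have "- max_Im x0 \<le> ln m"
          using \<open>0 < m\<close> by (simp add: ln_ge_iff)
        then show ?thesis by (simp add: \<Lambda>_def P_def)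
      qed
      then have "K * T \<le> E / (2 * E - 1) * (P - 1)"
        unfolding KT using E by (intro mult_left_mono) auto
      ultimately have "ln R + Im (x t $ j) \<le> P + E / (2 * E - 1) * (P - 1)"
        by (simp add: P_def)
      also have "\<dots> = (3 * E - 1) / (2 * E - 1) * P - E / (2 * E - 1)"
        using E by (simp add: divide_simps) (simp add: algebra_simps)
      finally have "exp (ln R + Im (x t $ j)) \<le> exp ((3 * E - 1) / (2 * E - 1) * P - E / (2 * E - 1))"
        by simp
      then show ?thesis
        using \<open>R > 0\<close> by (simp add: exp_add P_def distrib_left)
    qed
    have rate: "exp (real N) * q ^ N \<le> (E * m / R) powr ((E - 1) * real N / (2 * E - 1))"
    proof -
      have "exp (real N) * q ^ N = exp (real N * (K * t - \<Lambda>))"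
        by (simp add: q_eq exp_of_nat_mult[symmetric] exp_add[symmetric] algebra_simps)
      also have "\<dots> \<le> exp (real N * (K * T - \<Lambda>))"
        using \<open>K * t \<le> K * T\<close> by (simp add: mult_left_mono)
      also have "real N * (K * T - \<Lambda>) = (E - 1) * real N / (2 * E - 1) * (- \<Lambda>)"
        unfolding KT using E by (simp add: divide_simps) (simp add: algebra_simps)
      also have "- \<Lambda> = ln (E * m / R)"
        using \<open>0 < m\<close> \<open>R > 0\<close> by (simp add: \<Lambda>_def E_def ln_mult ln_div)
      finally show ?thesis
        using \<open>0 < m\<close> \<open>R > 0\<close> \<open>1 < E\<close> by (simp add: powr_def)
    qed

    have "v t (axis j 1) * exp (- \<i> * x t $ j) - 1
        = (v t (axis j 1) - exp (\<i> * x t $ j)) * exp (- \<i> * x t $ j)"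
      by (simp add: left_diff_distrib exp_minus)
    then have "norm (v t (axis j 1) * exp (- \<i> * x t $ j) - 1)
        = norm (v t (axis j 1) - exp (\<i> * x t $ j)) * exp (Im (x t $ j))"
      by (simp add: norm_mult)
    also have "\<dots> \<le> q ^ Suc N / (1 - q) * R * majorant_coeff N 1 * exp (real N * D0 * t) * exp (Im (x t $ j))"
      by (intro mult_right_mono err) auto
    also have "\<dots> = (q ^ Suc N / (1 - q) * majorant_coeff N 1) * (R * exp (Im (x t $ j))) * exp (real N * D0 * t)"
      by (simp add: mult_ac)
    also have "\<dots> \<le> (q ^ N / (E - 1) * (exp (real N) * real N powr (- 3 / 2) / sqrt (2 * pi)))
        * exp ((3 * E - 1) / (2 * E - 1) * max_Im x0 + (3 * E - 1) / (2 * E - 1) * ln R - E / (2 * E - 1))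
        * exp (real N * D0 * t)"
      using E \<open>0 < q\<close> \<open>R > 0\<close>
      by (intro mult_right_mono mult_mono tail coef Im_j) (auto simp: majorant_coeff_def)
    also have "\<dots> = C_0 R x0 * real N powr (- 3 / 2) * exp (D0 * t * real N) * (exp (real N) * q ^ N)"
      unfolding C_0_def E_def[symmetric] by (simp add: mult_ac)
    also have "\<dots> \<le> C_0 R x0 * real N powr (- 3 / 2) * exp (D0 * t * real N)
        * (E * m / R) powr ((E - 1) * real N / (2 * E - 1))"
      using E by (intro mult_left_mono rate) (auto simp: C_0_def E_def)
    finally show ?thesis .
  qed
  show ?thesis
    using \<open>0 < T\<close> main by (auto simp: T_def E_def m_def)
qed

end
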